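(* Let $A$ be a semi-simple commutative Banach algebra which is an ideal in its second dual $A^{**}$. Suppose that $B$ is an essential abstract Segal algebra in $A$. Then the following statements are equivalent: (i) $B$ is a BSE-algebra. (ii) $B=A$ and $A$ is a BSE-algebra.
   Context: A Banach algebra $B$ is an abstract Segal algebra in (of, with respect to) a Banach algebra $A$ if: (1) $B$ is a dense left ideal in $A$; (2) there exists $M>0$ such that $\|b\|_A\le M\|b\|_B$ for each $b\in B$; (3) there exists $C>0$ such that $\|ab\|_B\le C\|a\|_A\|b\|_B$ for all $a,b\in B$. It is essential if the linear span $\langle AB\rangle$ of $AB=\{ab: a\in A,\ b\in B\}$ is $\|\cdot\|_B$-dense in $B$. $A^{**}$ carries an Arens product, and $A$ is regarded as a subset of $A^{**}$ via the canonical embedding. BSE-algebras. A commutative Banach algebra $A$ is without order if $a\in A$ and $aA=\{0\}$ imply $a=0$. A multiplier of $A$ is a linear operator $T:A\to A$ with $aT(b)=T(a)b$ for all $a,b\in A$; $\mathcal{M}(A)$ is the space of all multipliers. $\Delta(A)$ is the space of characters (non-zero homomorphisms $A\to\mathbb{C}$) with the Gel'fand topology, and $\widehat{a}(\phi)=\phi(a)$. For each $T\in\mathcal{M}(A)$ there is a unique bounded continuous function $\widehat{T}$ on $\Delta(A)$ with $\widehat{T(a)}(\phi)=\widehat{T}(\phi)\widehat{a}(\phi)$ for all $a\in A$, $\phi\in\Delta(A)$; put $\widehat{\mathcal{M}(A)}=\{\widehat{T}:T\in\mathcal{M}(A)\}$. A bounded continuous function $\sigma$ on $\Delta(A)$ is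 a BSE-function if there is a constant $C>0$ such that for all $\phi_1,\dots,\phi_n\in\Delta(A)$ and $c_1,\dots,c_n\in\mathbb{C}$, $\left|\sum_{i=1}^n c_i\sigma(\phi_i)\right|\le C\left\|\sum_{i=1}^n c_i\phi_i\right\|_{A^*}$; $C_{\mathrm{BSE}}(\Delta(A))$ is the set of all BSE-functions. A without order commutative Banach algebra $A$ is a BSE-algebra if $C_{\mathrm{BSE}}(\Delta(A))=\widehat{\mathcal{M}(A)}$. *)

theory Defs
  imports "HOL-Analysis.Analysis"
begin

section \<open>Complex algebras and complex Banach algebras\<close>

class complex_algebra = ring +
  fixes scaleC :: "complex \<Rightarrow> 'a \<Rightarrow> 'a"  (infixr "*\<^sub>C" 75)
  assumes scaleC_add_right: "c *\<^sub>C (x + y) = c *\<^sub>C x + c *\<^sub>C y"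
    and scaleC_add_left: "(c + d) *\<^sub>C x = c *\<^sub>C x + d *\<^sub>C x"
    and scaleC_scaleC: "c *\<^sub>C d *\<^sub>C x = (c * d) *\<^sub>C x"
    and scaleC_one: "1 *\<^sub>C x = x"
    and mult_scaleC_left: "(c *\<^sub>C x) * y = c *\<^sub>C (x * y)"
    and mult_scaleC_right: "x * (c *\<^sub>C y) = c *\<^sub>C (x * y)"

text \<open>No unit is required.\<close>

class complex_banach_algebra = complex_algebra + real_normed_algebra + banach +
  assumes scaleR_scaleC: "r *\<^sub>R x = complex_of_real r *\<^sub>C x"
    and norm_scaleC: "norm (c *\<^sub>C x) = cmod c * norm x"

text \<open>
  An abstract Segal algebra is a subalgebra of the ambient algebra carrying a norm of its own.
  Notions that are needed both for the ambient algebra and for such a subalgebra are therefore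
  formulated for a carrier set \<open>X\<close> and a norm \<open>n\<close>, of which only the values on \<open>X\<close> matter; the
  ambient algebra itself is the pair \<open>UNIV\<close>, \<open>norm\<close>.
\<close>

definition banach_algebra_on :: "'a::complex_algebra set \<Rightarrow> ('a \<Rightarrow> real) \<Rightarrow> bool" where
  "banach_algebra_on X n \<longleftrightarrow>
     module.subspace scaleC X \<and>
     (\<forall>x\<in>X. \<forall>y\<in>X. x * y \<in> X) \<and>
     (\<forall>x\<in>X. 0 \<le> n x \<and> (n x = 0 \<longleftrightarrow> x = 0)) \<and>
     (\<forall>x\<in>X. \<forall>y\<in>X. n (x + y) \<le> n x + n y) \<and>
     (\<forall>c. \<forall>x\<in>X. n (c *\<^sub>C x) = cmod c * n x) \<and>
     (\<forall>x\<in>X. \<forall>y\<in>X. n (x * y) \<le> n x * n y) \<and>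
     (\<forall>s::nat \<Rightarrow> 'a. (\<forall>i. s i \<in> X) \<longrightarrow>
        (\<forall>e>0. \<exists>N. \<forall>i\<ge>N. \<forall>j\<ge>N. n (s i - s j) < e) \<longrightarrow>
        (\<exists>x\<in>X. (\<lambda>i. n (s i - x)) \<longlonglongrightarrow> 0))"


section \<open>Abstract Segal algebras\<close>

definition abstract_segal_algebra :: "'a::complex_banach_algebra set \<Rightarrow> ('a \<Rightarrow> real) \<Rightarrow> bool" where
  "abstract_segal_algebra B nB \<longleftrightarrow>
     banach_algebra_on B nB \<and>
     closure B = UNIV \<and>
     (\<forall>a. \<forall>b\<in>B. a * b \<in> B) \<and>
     (\<exists>M>0. \<forall>b\<in>B. norm b \<le> M * nB b) \<and>
     (\<exists>C>0. \<forall>a\<in>B. \<forall>b\<in>B. nB (a * b) \<le> C * norm a * nB b)"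

definition essential_abstract_segal_algebra ::
    "'a::complex_banach_algebra set \<Rightarrow> ('a \<Rightarrow> real) \<Rightarrow> bool" where
  "essential_abstract_segal_algebra B nB \<longleftrightarrow>
     abstract_segal_algebra B nB \<and>
     (\<forall>b\<in>B. \<forall>e>0. \<exists>s \<in> module.span scaleC {x * y |x y. y \<in> B}. nB (b - s) < e)"


section \<open>The second dual and the first Arens product\<close>

definition cdual :: "('a::complex_banach_algebra \<Rightarrow> complex) set" where
  "cdual = {f. bounded_linear f \<and> (\<forall>c x. f (c *\<^sub>C x) = c * f x)}"

text \<open>Elements of the second dual are normalised to be \<open>undefined\<close> off the dual.\<close>

definition cbidual :: "(('a::complex_banach_algebra \<Rightarrow> complex) \<Rightarrow> complex) set" where
  "cbidual = {F \<in> extensional cdual.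
     (\<forall>f\<in>cdual. \<forall>g\<in>cdual. F (\<lambda>x. f x + g x) = F f + F g) \<and>
     (\<forall>c. \<forall>f\<in>cdual. F (\<lambda>x. c * f x) = c * F f) \<and>
     (\<exists>K. \<forall>f\<in>cdual. cmod (F f) \<le> K * onorm f)}"

definition canonical_embedding ::
    "'a::complex_banach_algebra \<Rightarrow> ('a \<Rightarrow> complex) \<Rightarrow> complex" where
  "canonical_embedding a = (\<lambda>f\<in>cdual. f a)"

text \<open>
  With \<open>\<langle>f\<cdot>a, b\<rangle> = \<langle>f, ab\<rangle>\<close> and \<open>\<langle>G\<cdot>f, a\<rangle> = \<langle>G, f\<cdot>a\<rangle>\<close>, the first Arens product is
  \<open>\<langle>F \<box> G, f\<rangle> = \<langle>F, G\<cdot>f\<rangle>\<close>. The second Arens product gives the same products with elements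
  of the algebra, so being an ideal in the second dual does not depend on the choice.
\<close>

definition arens_product ::
    "(('a::complex_banach_algebra \<Rightarrow> complex) \<Rightarrow> complex) \<Rightarrow> (('a \<Rightarrow> complex) \<Rightarrow> complex)
      \<Rightarrow> ('a \<Rightarrow> complex) \<Rightarrow> complex" where
  "arens_product F G = (\<lambda>f\<in>cdual. F (\<lambda>a. G (\<lambda>b. f (a * b))))"

definition ideal_in_bidual :: "'a::complex_banach_algebra itself \<Rightarrow> bool" where
  "ideal_in_bidual TYPE('a) \<longleftrightarrow>
     (\<forall>a::'a. \<forall>F\<in>cbidual.
        arens_product (canonical_embedding a) F \<in> range canonical_embedding \<and>
        arens_product F (canonical_embedding a) \<in> range canonical_embedding)"


section \<open>Characters and multipliers\<close>

text \<open>
  The Gel'fand topology is the subspace topology inherited from the product topology on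
  \<open>'a \<Rightarrow> complex\<close>: all characters on \<open>X\<close> take the same value \<open>undefined\<close> off \<open>X\<close>, so this is
  pointwise convergence on \<open>X\<close>.
\<close>

definition characters :: "'a::complex_algebra set \<Rightarrow> ('a \<Rightarrow> complex) set" where
  "characters X = {\<phi> \<in> extensional X.
     (\<forall>x\<in>X. \<forall>y\<in>X. \<phi> (x + y) = \<phi> x + \<phi> y) \<and>
     (\<forall>c. \<forall>x\<in>X. \<phi> (c *\<^sub>C x) = c * \<phi> x) \<and>
     (\<forall>x\<in>X. \<forall>y\<in>X. \<phi> (x * y) = \<phi> x * \<phi> y) \<and>
     (\<exists>x\<in>X. \<phi> x \<noteq> 0)}"

text \<open>For commutative Banach algebras: the radical is the intersection of the kernels of the characters.\<close>

definition semisimple :: "'a::complex_algebra set \<Rightarrow> bool" where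
  "semisimple X \<longleftrightarrow> {x\<in>X. \<forall>\<phi>\<in>characters X. \<phi> x = 0} = {0}"

definition without_order :: "'a::complex_algebra set \<Rightarrow> bool" where
  "without_order X \<longleftrightarrow> (\<forall>a\<in>X. (\<forall>x\<in>X. a * x = 0) \<longrightarrow> a = 0)"

definition multipliers :: "'a::complex_algebra set \<Rightarrow> ('a \<Rightarrow> 'a) set" where
  "multipliers X = {T \<in> X \<rightarrow>\<^sub>E X.
     (\<forall>x\<in>X. \<forall>y\<in>X. T (x + y) = T x + T y) \<and>
     (\<forall>c. \<forall>x\<in>X. T (c *\<^sub>C x) = c *\<^sub>C T x) \<and>
     (\<forall>a\<in>X. \<forall>b\<in>X. a * T b = T a * b)}"

definition bounded_continuous_on_characters ::
    "'a::complex_algebra set \<Rightarrow> (('a \<Rightarrow> complex) \<Rightarrow> complex) set" where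
  "bounded_continuous_on_characters X =
     {\<sigma> \<in> extensional (characters X).
        continuous_on (characters X) \<sigma> \<and> bounded (\<sigma> ` characters X)}"

definition is_multiplier_transform ::
    "'a::complex_algebra set \<Rightarrow> ('a \<Rightarrow> 'a) \<Rightarrow> (('a \<Rightarrow> complex) \<Rightarrow> complex) \<Rightarrow> bool" where
  "is_multiplier_transform X T \<sigma> \<longleftrightarrow>
     \<sigma> \<in> bounded_continuous_on_characters X \<and>
     (\<forall>a\<in>X. \<forall>\<phi>\<in>characters X. \<phi> (T a) = \<sigma> \<phi> * \<phi> a)"

definition multiplier_transforms ::
    "'a::complex_algebra set \<Rightarrow> (('a \<Rightarrow> complex) \<Rightarrow> complex) set" where
  "multiplier_transforms X = {\<sigma>. \<exists>T\<in>multipliers X. is_multiplier_transform X T \<sigma>}"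


section \<open>BSE-algebras\<close>

text \<open>As in \<^const>\<open>onorm\<close>, the value \<open>0 / 0 = 0\<close> at the origin does no harm.\<close>

definition dual_norm ::
    "'a::complex_algebra set \<Rightarrow> ('a \<Rightarrow> real) \<Rightarrow> ('a \<Rightarrow> complex) \<Rightarrow> real" where
  "dual_norm X n f = (SUP x\<in>X. cmod (f x) / n x)"

definition BSE_functions ::
    "'a::complex_algebra set \<Rightarrow> ('a \<Rightarrow> real) \<Rightarrow> (('a \<Rightarrow> complex) \<Rightarrow> complex) set" where
  "BSE_functions X n = {\<sigma> \<in> bounded_continuous_on_characters X.
     \<exists>C>0. \<forall>(m::nat) \<phi> c. (\<forall>i<m. \<phi> i \<in> characters X) \<longrightarrow>
       cmod (\<Sum>i<m. c i * \<sigma> (\<phi> i)) \<le> C * dual_norm X n (\<lambda>x. \<Sum>i<m. c i * \<phi> i x)}"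

definition BSE_algebra :: "'a::complex_algebra set \<Rightarrow> ('a \<Rightarrow> real) \<Rightarrow> bool" where
  "BSE_algebra X n \<longleftrightarrow>
     banach_algebra_on X n \<and>
     (\<forall>x\<in>X. \<forall>y\<in>X. x * y = y * x) \<and>
     without_order X \<and>
     BSE_functions X n = multiplier_transforms X"


section \<open>Consistency of the definitions\<close>

lemma module_scaleC: "module (scaleC :: complex \<Rightarrow> 'a::complex_algebra \<Rightarrow> 'a)"
  by unfold_locales
    (simp_all add: scaleC_add_right scaleC_add_left scaleC_scaleC scaleC_one)

lemma banach_algebra_on_UNIV:
  "banach_algebra_on (UNIV :: 'a::complex_banach_algebra set) norm"
proof -
  have "\<exists>x. (\<lambda>i. norm (s i - x)) \<longlonglongrightarrow> 0"
    if "\<forall>e>0. \<exists>N. \<forall>i\<ge>N. \<forall>j\<ge>N. norm (s i - s j) < e" for s :: "nat \<Rightarrow> 'a"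
  proof -
    have "Cauchy s"
      using that by (simp add: Cauchy_def dist_norm)
    then obtain x where "s \<longlonglongrightarrow> x"
      using Cauchy_convergent convergent_def by blast
    then show ?thesis
      using LIM_zero tendsto_norm_zero by blast
  qed
  then show ?thesis
    unfolding banach_algebra_on_def
    by (auto simp: module.subspace_UNIV[OF module_scaleC] norm_triangle_ineq norm_scaleC
        norm_mult_ineq)
qed

lemma dual_norm_UNIV: "dual_norm UNIV norm f = onorm f"
  by (simp add: dual_norm_def onorm_def)

lemma multiplier_transform_unique:
  assumes "is_multiplier_transform X T \<sigma>" "is_multiplier_transform X T \<tau>"
  shows "\<sigma> = \<tau>"
proof (rule extensionalityI[where A = "characters X"])
  show "\<sigma> \<in> extensional (characters X)" "\<tau> \<in> extensional (characters X)"
    using assms by (auto simp: is_multiplier_transform_def bounded_continuous_on_characters_def)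
next
  fix \<phi> assume \<phi>: "\<phi> \<in> characters X"
  then obtain a where "a \<in> X" "\<phi> a \<noteq> 0"
    by (auto simp: characters_def)
  then show "\<sigma> \<phi> = \<tau> \<phi>"
    using assms \<phi> by (metis is_multiplier_transform_def mult_right_cancel)
qed

end

(*
  A BSE-algebra B carries a functional F on the dual of A which is 1 on all characters and
  satisfies |F f| <= C ||f|B||, by Hahn-Banach. Since A is a semisimple ideal in its bidual,
  F(x |-> f(x a)) = f(a) for all f in the dual of A and all a. For a functional g on B, the maps
  x |-> g(x b) belong to the dual of A, so g(s) = F(x |-> g(x s)) for s in the span of AB; taking
  g of norm 1 with g(s) = ||s||_B gives ||s||_B <= const ||s||_A. As B is essential, the two norms
  are equivalent on B, which is therefore closed, hence all of A. Conversely, if B = A, then the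
  norms are equivalent by the open mapping theorem, and the BSE property only depends on the norm
  up to equivalence.
*)
theory Submission
  imports Defs "HOL-Library.Function_Algebras"
begin

text \<open>The final estimate depends on which norm dominates \<open>F\<close>. For
  \<open>s\<close> and \<open>x\<close> in B, commutativity gives |g(x s)| = |g(s x)| <= C ||s||_A
  ||x||_B, so x |-> g(x s) has norm at most C ||s||_A as a functional on B. As a functional on A its
  norm is only known to be at most C ||s||_B, which would give nothing. Hence \<open>F\<close> has
  to be bounded by the norm of the restriction to B.

  A functional g on B need not be continuous for the norm of A, so the identity for the dual of A
  cannot be applied to g itself. A factor from B repairs this: x |-> g(x b) is continuous on A. This
  yields the identity for products, then for their span, and essentiality carries the resulting norm
  estimate to all of B.

  Hahn-Banach is applied once to the dual of A and once to B with its own norm. Both are subsets of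
  larger types, which is why it is stated for a carrier \<open>V\<close> with an explicit scaling
  \<open>s\<close>.\<close>

text \<open>A partial linear functional, given by its graph. Single-valuedness is not demanded: it
  follows once the graph is dominated by a sublinear \<open>p\<close>. This keeps extensions and
  unions simple.\<close>

definition linear_graph :: "('k::field \<Rightarrow> 'b::ab_group_add \<Rightarrow> 'b) \<Rightarrow> ('b \<times> 'k) set \<Rightarrow> bool" where
  "linear_graph s G \<longleftrightarrow> (0, 0) \<in> G \<and>
     (\<forall>v t w u. (v, t) \<in> G \<longrightarrow> (w, u) \<in> G \<longrightarrow> (v + w, t + u) \<in> G) \<and>
     (\<forall>c v t. (v, t) \<in> G \<longrightarrow> (s c v, c * t) \<in> G)"

lemma linear_graph_zero: "linear_graph s G \<Longrightarrow> (0, 0) \<in> G"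
  and linear_graph_add: "linear_graph s G \<Longrightarrow> (v, t) \<in> G \<Longrightarrow> (w, u) \<in> G \<Longrightarrow> (v + w, t + u) \<in> G"
  and linear_graph_scale: "linear_graph s G \<Longrightarrow> (v, t) \<in> G \<Longrightarrow> (s c v, c * t) \<in> G"
  by (auto simp: linear_graph_def)

lemma linear_graph_Union:
  assumes "\<C> \<noteq> {}" "\<And>G H. G \<in> \<C> \<Longrightarrow> H \<in> \<C> \<Longrightarrow> G \<subseteq> H \<or> H \<subseteq> G"
    and lin: "\<And>G. G \<in> \<C> \<Longrightarrow> linear_graph s G"
  shows "linear_graph s (\<Union>\<C>)"
  unfolding linear_graph_def
proof (intro conjI allI impI)
  show "(0, 0) \<in> \<Union>\<C>"
    using assms(1) lin linear_graph_zero by blast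
next
  fix v t w u assume "(v, t) \<in> \<Union>\<C>" "(w, u) \<in> \<Union>\<C>"
  then obtain G H where GH: "G \<in> \<C>" "(v, t) \<in> G" "H \<in> \<C>" "(w, u) \<in> H" by blast
  then have "(v, t) \<in> G \<union> H" "(w, u) \<in> G \<union> H" "G \<union> H \<in> \<C>"
    using assms(2)[of G H] by (auto simp: sup.absorb1 sup.absorb2)
  then show "(v + w, t + u) \<in> \<Union>\<C>"
    using lin linear_graph_add by blast
next
  fix c v t assume "(v, t) \<in> \<Union>\<C>"
  then show "(s c v, c * t) \<in> \<Union>\<C>"
    using lin linear_graph_scale by blast
qed

section \<open>The Hahn-Banach theorem\<close>

text \<open>A value \<open>a\<close> at \<open>x\<close> is admissible if t - p(v - x) <= a <= p(w +
  x) - u for all pairs (v, t), (w, u) in \<open>G\<close>. Sublinearity puts every left side below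
  every right side, and \<open>a\<close> is the supremum of the left sides. No case distinction is
  made on whether \<open>x\<close> already lies in the domain.\<close>

lemma linear_graph_extend:
  fixes s :: "real \<Rightarrow> 'b::ab_group_add \<Rightarrow> 'b"
  assumes "module s" and V: "module.subspace s V"
    and p_add: "\<And>v w. v \<in> V \<Longrightarrow> w \<in> V \<Longrightarrow> p (v + w) \<le> p v + p w"
    and p_scale: "\<And>r v. 0 \<le> r \<Longrightarrow> v \<in> V \<Longrightarrow> p (s r v) = r * p v"
    and G: "linear_graph s G" "G \<subseteq> V \<times> UNIV" "\<And>v t. (v, t) \<in> G \<Longrightarrow> t \<le> p v"
    and x: "x \<in> V"
  obtains H a where "linear_graph s H" "H \<subseteq> V \<times> UNIV" "\<And>v t. (v, t) \<in> H \<Longrightarrow> t \<le> p v"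
    "G \<subseteq> H" "(x, a) \<in> H"
proof -
  interpret module s by fact
  have *: "t - p (v - x) \<le> p (w + x) - u" if "(v, t) \<in> G" "(w, u) \<in> G" for v t w u
  proof -
    have "v \<in> V" "w \<in> V" using that G by auto
    then have "p ((v - x) + (w + x)) \<le> p (v - x) + p (w + x)"
      using V x by (intro p_add subspace_add subspace_diff)
    moreover have "t + u \<le> p (v + w)"
      using linear_graph_add[OF G(1) that] G(3) by blast
    ultimately show ?thesis by simp
  qed
  define a where "a = (SUP (v, t)\<in>G. t - p (v - x))"
  have bdd: "bdd_above ((\<lambda>(v, t). t - p (v - x)) ` G)"
    using *[OF _ linear_graph_zero[OF G(1)]] by (auto intro!: bdd_aboveI2)
  have lower: "t - p (v - x) \<le> a" if "(v, t) \<in> G" for v t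
    unfolding a_def using cSUP_upper[OF that bdd] by simp
  have upper: "a \<le> p (w + x) - u" if "(w, u) \<in> G" for w u
    unfolding a_def using G(1) * that by (intro cSUP_least) (auto dest: linear_graph_zero)
  define H where "H = {(v + s r x, t + r * a) |v t r. (v, t) \<in> G}"
  have "linear_graph s H"
    unfolding linear_graph_def
  proof (intro conjI allI impI)
    show "(0, 0) \<in> H"
      unfolding H_def using linear_graph_zero[OF G(1)] by (force intro: exI[of _ 0])
  next
    fix v t w u assume "(v, t) \<in> H" "(w, u) \<in> H"
    then obtain v' t' r w' u' q where eq: "(v', t') \<in> G" "v = v' + s r x" "t = t' + r * a"
      "(w', u') \<in> G" "w = w' + s q x" "u = u' + q * a" by (auto simp: H_def)
    have "v + w = (v' + w') + s (r + q) x" "t + u = (t' + u') + (r + q) * a"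
      by (simp_all add: eq scale_left_distrib algebra_simps)
    then show "(v + w, t + u) \<in> H"
      using linear_graph_add[OF G(1) eq(1,4)] unfolding H_def by blast
  next
    fix c v t assume "(v, t) \<in> H"
    then obtain v' t' r where eq: "(v', t') \<in> G" "v = v' + s r x" "t = t' + r * a"
      by (auto simp: H_def)
    have "s c v = s c v' + s (c * r) x" "c * t = c * t' + (c * r) * a"
      by (simp_all add: eq scale_right_distrib algebra_simps)
    then show "(s c v, c * t) \<in> H"
      using linear_graph_scale[OF G(1) eq(1)] unfolding H_def by blast
  qed
  moreover have "H \<subseteq> V \<times> UNIV"
    using G(2) V x by (auto simp: H_def intro!: subspace_add subspace_scale)
  moreover have "t \<le> p v" if vt: "(v, t) \<in> H" for v t
  proof -
    obtain v' t' r where eq: "(v', t') \<in> G" "v = v' + s r x" "t = t' + r * a"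
      using vt by (auto simp: H_def)
    have v': "v' \<in> V" using eq G(2) by auto
    consider "r = 0" | "r > 0" | "r < 0" by linarith
    then show ?thesis
    proof cases
      case 1
      then show ?thesis using eq G(3) by simp
    next
      case 2
      \<comment> \<open>Positive homogeneity reduces the coefficient of \<open>x\<close> to 1, where
        \<open>upper\<close> applies. For negative \<open>r\<close> it is reduced to -1, where
        \<open>lower\<close> applies.\<close>
      define w where "w = s (1 / r) v'"
      have w: "w \<in> V"
        using v' V by (simp add: w_def subspace_scale)
      have Gw: "(w, 1 / r * t') \<in> G"
        unfolding w_def using eq(1) by (intro linear_graph_scale[OF G(1)])
      have "v = s r (w + x)"
        using 2 by (simp add: eq w_def scale_right_distrib)
      then have "p v = r * p (w + x)"
        using 2 p_scale V w x by (simp add: subspace_add)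
      moreover have "r * a \<le> r * (p (w + x) - 1 / r * t')"
        using upper[OF Gw] 2 by (intro mult_left_mono) auto
      ultimately show ?thesis
        using 2 by (simp add: eq algebra_simps)
    next
      case 3
      define w where "w = s (- 1 / r) v'"
      have w: "w \<in> V"
        using v' V by (simp add: w_def subspace_scale subspace_neg)
      have Gw: "(w, - 1 / r * t') \<in> G"
        unfolding w_def using eq(1) by (intro linear_graph_scale[OF G(1)])
      have "v = s (- r) (w - x)"
        using 3 by (simp add: eq w_def scale_right_diff_distrib)
      then have "p v = - r * p (w - x)"
        using 3 p_scale[of "- r" "w - x"] V w x by (simp add: subspace_diff)
      moreover have "(- r) * (- 1 / r * t' - p (w - x)) \<le> (- r) * a"
        using lower[OF Gw] 3 by (intro mult_left_mono) auto
      ultimately show ?thesis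
        using 3 by (simp add: eq algebra_simps)
    qed
  qed
  moreover have "G \<subseteq> H"
    unfolding H_def by (force intro: exI[of _ 0])
  moreover have "(x, a) \<in> H"
    unfolding H_def using linear_graph_zero[OF G(1)] by (force intro: exI[of _ 1])
  ultimately show ?thesis using that by blast
qed

text \<open>Zorn's lemma for dominated linear graphs above \<open>G\<close>: by one-step extension,
  a maximal one has a value at every point of \<open>V\<close>.\<close>

lemma real_Hahn_Banach:
  fixes s :: "real \<Rightarrow> 'b::ab_group_add \<Rightarrow> 'b"
  assumes "module s" and V: "module.subspace s V"
    and p_add: "\<And>v w. v \<in> V \<Longrightarrow> w \<in> V \<Longrightarrow> p (v + w) \<le> p v + p w"
    and p_scale: "\<And>r v. 0 \<le> r \<Longrightarrow> v \<in> V \<Longrightarrow> p (s r v) = r * p v"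
    and G: "linear_graph s G" "G \<subseteq> V \<times> UNIV" "\<And>v t. (v, t) \<in> G \<Longrightarrow> t \<le> p v"
  obtains F where "\<And>v w. v \<in> V \<Longrightarrow> w \<in> V \<Longrightarrow> F (v + w) = F v + F w"
    "\<And>r v. v \<in> V \<Longrightarrow> F (s r v) = r * F v" "\<And>v. v \<in> V \<Longrightarrow> F v \<le> p v"
    "\<And>v t. (v, t) \<in> G \<Longrightarrow> F v = t"
proof -
  interpret module s by fact
  define \<A> where "\<A> = {H. linear_graph s H \<and> H \<subseteq> V \<times> UNIV \<and> (\<forall>(v, t)\<in>H. t \<le> p v) \<and> G \<subseteq> H}"
  have "\<Union>\<C> \<in> \<A>" if "\<C> \<noteq> {}" "subset.chain \<A> \<C>" for \<C>
  proof -
    have sub: "\<C> \<subseteq> \<A>" and "\<And>G H. G \<in> \<C> \<Longrightarrow> H \<in> \<C> \<Longrightarrow> G \<subseteq> H \<or> H \<subseteq> G"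
      using that by (auto simp: subset_chain_def)
    then have "linear_graph s (\<Union>\<C>)"
      using \<open>\<C> \<noteq> {}\<close> by (intro linear_graph_Union) (auto simp: \<A>_def)
    then show ?thesis
      using sub \<open>\<C> \<noteq> {}\<close> unfolding \<A>_def by blast
  qed
  moreover have "G \<in> \<A>" using G by (auto simp: \<A>_def)
  ultimately obtain M where M: "M \<in> \<A>" and max: "\<And>X. X \<in> \<A> \<Longrightarrow> M \<subseteq> X \<Longrightarrow> X = M"
    using subset_Zorn_nonempty[of \<A>] by blast
  have lin: "linear_graph s M" and MV: "M \<subseteq> V \<times> UNIV" and dom: "\<And>v t. (v, t) \<in> M \<Longrightarrow> t \<le> p v"
    and GM: "G \<subseteq> M"
    using M by (auto simp: \<A>_def)
  have total: "\<exists>a. (x, a) \<in> M" if x: "x \<in> V" for x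
  proof -
    obtain H a where H: "linear_graph s H" "H \<subseteq> V \<times> UNIV" "\<And>v t. (v, t) \<in> H \<Longrightarrow> t \<le> p v"
      "M \<subseteq> H" "(x, a) \<in> H"
      using linear_graph_extend[of s V p M x, OF assms(1-4) lin MV dom x] by blast
    then have "H \<in> \<A>" using GM by (auto simp: \<A>_def)
    then show ?thesis using max H by blast
  qed
  have p0: "p 0 = 0"
    using p_scale[of 0 0] V by (simp add: subspace_0)
  \<comment> \<open>The difference of two values at \<open>v\<close> is a value at 0, hence at most
    \<open>p 0\<close>, which is 0. By symmetry the values coincide.\<close>
  have le: "t \<le> u" if "(v, t) \<in> M" "(v, u) \<in> M" for v t u
    using dom[OF linear_graph_add[OF lin that(1) linear_graph_scale[OF lin that(2), of "- 1"]]] p0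
    by simp
  define F where "F v = (THE t. (v, t) \<in> M)" for v
  have F: "F v = t" if "(v, t) \<in> M" for v t
    unfolding F_def using that le by (intro the_equality) (auto intro: antisym)
  have FM: "(v, F v) \<in> M" if "v \<in> V" for v
    using total[OF that] F by auto
  show ?thesis
  proof
    show "F (v + w) = F v + F w" if "v \<in> V" "w \<in> V" for v w
      using linear_graph_add[OF lin FM[OF that(1)] FM[OF that(2)]] by (rule F)
    show "F (s r v) = r * F v" if "v \<in> V" for r v
      using linear_graph_scale[OF lin FM[OF that]] by (rule F)
    show "F v \<le> p v" if "v \<in> V" for v
      using dom[OF FM[OF that]] .
    show "F v = t" if "(v, t) \<in> G" for v t
      using F GM that by blast
  qed
qed

text \<open>A complex linear functional is determined by its real part, so the real theorem is
  applied to the real parts of the values in \<open>G\<close>. A rotation of the argument turns the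
  bound on the real part into one on the modulus.\<close>

lemma complex_Hahn_Banach:
  fixes s :: "complex \<Rightarrow> 'b::ab_group_add \<Rightarrow> 'b"
  assumes "module s" and V: "module.subspace s V"
    and p_add: "\<And>v w. v \<in> V \<Longrightarrow> w \<in> V \<Longrightarrow> p (v + w) \<le> p v + p w"
    and p_scale: "\<And>c v. v \<in> V \<Longrightarrow> p (s c v) = cmod c * p v"
    and G: "linear_graph s G" "G \<subseteq> V \<times> UNIV" "\<And>v t. (v, t) \<in> G \<Longrightarrow> cmod t \<le> p v"
  obtains F where "\<And>v w. v \<in> V \<Longrightarrow> w \<in> V \<Longrightarrow> F (v + w) = F v + F w"
    "\<And>c v. v \<in> V \<Longrightarrow> F (s c v) = c * F v" "\<And>v. v \<in> V \<Longrightarrow> cmod (F v) \<le> p v"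
    "\<And>v t. (v, t) \<in> G \<Longrightarrow> F v = t"
proof -
  interpret module s by fact
  define s' where "s' r = s (of_real r)" for r
  have m': "module s'"
    by unfold_locales (simp_all add: s'_def scale_right_distrib scale_left_distrib)
  have V': "module.subspace s' V"
    using V unfolding module.subspace_def[OF m'] subspace_def s'_def by blast
  have ps': "p (s' r v) = r * p v" if "0 \<le> r" "v \<in> V" for r v
    using that by (simp add: s'_def p_scale)
  define G' where "G' = {(v, Re t) |v t. (v, t) \<in> G}"
  have lin': "linear_graph s' G'"
    unfolding linear_graph_def
  proof (intro conjI allI impI)
    show "(0, 0) \<in> G'"
      using linear_graph_zero[OF G(1)] unfolding G'_def by force
  next
    fix v t w u assume "(v, t) \<in> G'" "(w, u) \<in> G'"
    then show "(v + w, t + u) \<in> G'"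
      using linear_graph_add[OF G(1)] unfolding G'_def
      by clarsimp (metis plus_complex.sel(1))
  next
    fix c v t assume "(v, t) \<in> G'"
    then obtain z where z: "(v, z) \<in> G" "t = Re z" by (auto simp: G'_def)
    then have "(s' c v, of_real c * z) \<in> G" "c * t = Re (of_real c * z)"
      using linear_graph_scale[OF G(1)] by (auto simp: s'_def)
    then show "(s' c v, c * t) \<in> G'"
      unfolding G'_def by blast
  qed
  have "t \<le> p v" if "(v, t) \<in> G'" for v t
    using that G(3) order_trans[OF complex_Re_le_cmod] unfolding G'_def by blast
  moreover have "G' \<subseteq> V \<times> UNIV"
    using G(2) by (auto simp: G'_def)
  ultimately obtain R where R_add: "\<And>v w. v \<in> V \<Longrightarrow> w \<in> V \<Longrightarrow> R (v + w) = R v + R w"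
    and R_scale: "\<And>r v. v \<in> V \<Longrightarrow> R (s' r v) = r * R v" and R_le: "\<And>v. v \<in> V \<Longrightarrow> R v \<le> p v"
    and R_G: "\<And>v t. (v, t) \<in> G' \<Longrightarrow> R v = t"
    using real_Hahn_Banach[of s' V p G', OF m' V' p_add ps' lin'] by blast
  \<comment> \<open>The only complex linear functional with real part \<open>R\<close>: its
    imaginary part at v is minus its real part at iv.\<close>
  define F where "F v = Complex (R v) (- R (s \<i> v))" for v
  have R_complex: "R (s c v) = Re c * R v + Im c * R (s \<i> v)" if "v \<in> V" for c v
  proof -
    have "s c v = s (of_real (Re c) + of_real (Im c) * \<i>) v"
      by (metis complex_eq mult.commute)
    also have "\<dots> = s' (Re c) v + s' (Im c) (s \<i> v)"
      by (simp only: s'_def scale_left_distrib scale_scale)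
    finally show ?thesis
      using V V' that by (simp add: R_add R_scale subspace_scale module.subspace_scale[OF m'])
  qed
  have F_scale: "F (s c v) = c * F v" if "v \<in> V" for c v
    using R_complex[OF that, of c] R_complex[OF that, of "\<i> * c"]
    by (simp add: F_def complex_eq_iff)
  show ?thesis
  proof
    show "F (v + w) = F v + F w" if "v \<in> V" "w \<in> V" for v w
      using that V by (simp add: F_def complex_eq_iff scale_right_distrib R_add subspace_scale)
    show "F (s c v) = c * F v" if "v \<in> V" for c v
      using that by (rule F_scale)
    show "cmod (F v) \<le> p v" if "v \<in> V" for v
    proof (cases "F v = 0")
      case True
      \<comment> \<open>Both R v and -R v are at most \<open>p v\<close>, since p(-v) = p v.\<close>
      have "0 \<le> p v"
        using R_le[OF that] R_le[of "s (- 1) v"] R_complex[OF that, of "- 1"]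
          p_scale[OF that, of "- 1"] V that
        by (simp add: subspace_neg)
      then show ?thesis using True by simp
    next
      case False
      \<comment> \<open>The unimodular factor that rotates \<open>F v\<close> onto the nonnegative
        real axis.\<close>
      define c where "c = cnj (F v) / cmod (F v)"
      have c: "cmod c = 1" using False by (simp add: c_def norm_divide)
      have "F (s c v) = cmod (F v)"
        using False that complex_norm_square[of "F v"]
        by (simp add: F_scale c_def power2_eq_square mult.commute nonzero_divide_eq_eq)
      then have "cmod (F v) = R (s c v)"
        by (simp add: F_def complex_eq_iff)
      also have "\<dots> \<le> p (s c v)"
        using R_le V that by (simp add: subspace_scale)
      finally show ?thesis using c that by (simp add: p_scale)
    qed
    show "F v = t" if "(v, t) \<in> G" for v t
    proof -
      \<comment> \<open>Since Re(i t) = -Im t, the second pair fixes the imaginary part of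
        \<open>F v\<close>.\<close>
      have "(v, Re t) \<in> G'" "(s \<i> v, Re (\<i> * t)) \<in> G'"
        using that linear_graph_scale[OF G(1)] unfolding G'_def by blast+
      then show ?thesis
        using R_G by (force simp: F_def complex_eq_iff)
    qed
  qed
qed

section \<open>Complete norms on a carrier\<close>

context
  fixes X :: "'a::complex_algebra set" and n :: "'a \<Rightarrow> real"
  assumes X: "banach_algebra_on X n"
begin

lemma carrier_subspace: "module.subspace scaleC X"
  and carrier_mult: "x \<in> X \<Longrightarrow> y \<in> X \<Longrightarrow> x * y \<in> X"
  and carrier_norm_nonneg: "x \<in> X \<Longrightarrow> 0 \<le> n x"
  and carrier_norm_eq_0: "x \<in> X \<Longrightarrow> n x = 0 \<longleftrightarrow> x = 0"
  and carrier_norm_add: "x \<in> X \<Longrightarrow> y \<in> X \<Longrightarrow> n (x + y) \<le> n x + n y"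
  and carrier_norm_scaleC: "x \<in> X \<Longrightarrow> n (c *\<^sub>C x) = cmod c * n x"
  and carrier_complete: "(\<And>i. s i \<in> X) \<Longrightarrow>
    (\<And>e. 0 < e \<Longrightarrow> \<exists>N. \<forall>i\<ge>N. \<forall>j\<ge>N. n (s i - s j) < e) \<Longrightarrow> \<exists>x\<in>X. (\<lambda>i. n (s i - x)) \<longlonglongrightarrow> 0"
  using X by (auto simp: banach_algebra_on_def)

lemma carrier_zero: "0 \<in> X"
  and carrier_add: "x \<in> X \<Longrightarrow> y \<in> X \<Longrightarrow> x + y \<in> X"
  and carrier_diff: "x \<in> X \<Longrightarrow> y \<in> X \<Longrightarrow> x - y \<in> X"
  and carrier_scaleC: "x \<in> X \<Longrightarrow> c *\<^sub>C x \<in> X"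
  using carrier_subspace
    module.subspace_0[OF module_scaleC] module.subspace_add[OF module_scaleC]
    module.subspace_diff[OF module_scaleC] module.subspace_scale[OF module_scaleC] by auto

lemma carrier_norm_minus: "x \<in> X \<Longrightarrow> n (- x) = n x"
  using carrier_norm_scaleC[of x "- 1"] module.scale_minus_left[OF module_scaleC, of 1 x]
  by (simp add: scaleC_one)

lemma carrier_norm_diff: "x \<in> X \<Longrightarrow> y \<in> X \<Longrightarrow> n (x - y) \<le> n x + n y"
  using carrier_norm_add[of x "- y"] carrier_norm_minus[of y]
    module.subspace_neg[OF module_scaleC carrier_subspace] by simp

lemma carrier_norm_diff_commute: "x \<in> X \<Longrightarrow> y \<in> X \<Longrightarrow> n (x - y) = n (y - x)"
  using carrier_norm_minus[of "x - y"] by (simp add: carrier_diff)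

lemma dual_norm_least:
  assumes "0 \<le> K" "\<And>x. x \<in> X \<Longrightarrow> cmod (f x) \<le> K * n x"
  shows "dual_norm X n f \<le> K"
  unfolding dual_norm_def
proof (rule cSUP_least)
  fix x assume x: "x \<in> X"
  show "cmod (f x) / n x \<le> K"
    using assms x carrier_norm_nonneg[OF x] by (cases "n x = 0") (auto simp: divide_le_eq)
qed (use carrier_zero in auto)

text \<open>\<open>dual_norm\<close> is a supremum of reals and carries information only for a
  bounded set of quotients. The hypothesis with \<open>K\<close> certifies boundedness; the
  conclusion has the supremum itself as constant.\<close>

lemma dual_norm_bound:
  assumes K: "\<And>x. x \<in> X \<Longrightarrow> cmod (f x) \<le> K * n x" and x: "x \<in> X"
  shows "cmod (f x) \<le> dual_norm X n f * n x"
proof (cases "n x = 0")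
  case True
  then show ?thesis using K[OF x] by simp
next
  case False
  \<comment> \<open>At the origin the quotient is 0, which a negative \<open>K\<close> would not
    bound.\<close>
  have "cmod (f y) / n y \<le> max K 0" if "y \<in> X" for y
  proof (cases "n y = 0")
    case False
    have "cmod (f y) \<le> max K 0 * n y"
      using K[OF that] mult_right_mono[OF max.cobounded1 carrier_norm_nonneg[OF that]]
      by (rule order_trans)
    then show ?thesis
      using False carrier_norm_nonneg[OF that] by (simp add: divide_le_eq)
  qed simp
  then have "bdd_above ((\<lambda>x. cmod (f x) / n x) ` X)"
    by (intro bdd_aboveI2)
  then have "cmod (f x) / n x \<le> dual_norm X n f"
    unfolding dual_norm_def by (rule cSUP_upper[OF x])
  then show ?thesis
    using False carrier_norm_nonneg[OF x] by (simp add: divide_le_eq)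
qed

lemma dual_norm_nonneg:
  assumes "\<And>x. x \<in> X \<Longrightarrow> cmod (f x) \<le> K * n x"
  shows "0 \<le> dual_norm X n f"
proof (cases "X = {0}")
  case True
  then show ?thesis using carrier_norm_eq_0[of 0] by (simp add: dual_norm_def)
next
  case False
  then obtain x where x: "x \<in> X" "x \<noteq> 0" using carrier_zero by blast
  then have "0 < n x" using carrier_norm_nonneg[of x] carrier_norm_eq_0[of x] by linarith
  moreover have "0 \<le> dual_norm X n f * n x"
    using dual_norm_bound[OF assms x(1)] norm_ge_zero order_trans by blast
  ultimately show ?thesis by (simp add: zero_le_mult_iff)
qed

lemma dual_norm_add:
  assumes f: "\<And>x. x \<in> X \<Longrightarrow> cmod (f x) \<le> K * n x"
    and g: "\<And>x. x \<in> X \<Longrightarrow> cmod (g x) \<le> L * n x"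
  shows "dual_norm X n (\<lambda>x. f x + g x) \<le> dual_norm X n f + dual_norm X n g"
proof (rule dual_norm_least)
  show "0 \<le> dual_norm X n f + dual_norm X n g"
    using dual_norm_nonneg[of f, OF f] dual_norm_nonneg[of g, OF g] by simp
  show "cmod (f x + g x) \<le> (dual_norm X n f + dual_norm X n g) * n x" if "x \<in> X" for x
    using norm_triangle_ineq[of "f x" "g x"] dual_norm_bound[of f, OF f that]
      dual_norm_bound[of g, OF g that] by (simp add: distrib_right)
qed

lemma dual_norm_mult:
  assumes f: "\<And>x. x \<in> X \<Longrightarrow> cmod (f x) \<le> K * n x"
  shows "dual_norm X n (\<lambda>x. c * f x) = cmod c * dual_norm X n f"
proof -
  \<comment> \<open>One inequality for arbitrary factors suffices: with \<open>inverse c\<close> and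
    \<open>c * f\<close> it yields the reverse one.\<close>
  have le: "dual_norm X n (\<lambda>x. c * g x) \<le> cmod c * dual_norm X n g"
    if g: "\<And>x. x \<in> X \<Longrightarrow> cmod (g x) \<le> L * n x" for c g L
    using dual_norm_nonneg[of g, OF g] dual_norm_bound[of g, OF g]
    by (intro dual_norm_least) (auto simp: norm_mult mult.assoc intro: mult_left_mono)
  have cf: "cmod (c * f x) \<le> cmod c * K * n x" if "x \<in> X" for x
    using f[OF that] by (simp add: norm_mult mult.assoc mult_left_mono)
  show ?thesis
  proof (cases "c = 0")
    case True
    have "dual_norm X n (\<lambda>x. c * f x) \<le> 0" "0 \<le> dual_norm X n (\<lambda>x. c * f x)"
      using le[of f, OF f, of c] dual_norm_nonneg[of "\<lambda>x. c * f x", OF cf] True by simp_all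
    then show ?thesis using True by simp
  next
    case False
    then have "(\<lambda>x. inverse c * (c * f x)) = f" by (auto simp: fun_eq_iff)
    then have "dual_norm X n f \<le> dual_norm X n (\<lambda>x. c * f x) / cmod c"
      using le[of "\<lambda>x. c * f x", OF cf, of "inverse c"]
      by (simp add: norm_inverse divide_inverse mult.commute)
    then have "cmod c * dual_norm X n f \<le> dual_norm X n (\<lambda>x. c * f x)"
      using False by (simp add: le_divide_eq mult.commute)
    then show ?thesis using le[of f, OF f] by (intro antisym)
  qed
qed

end

section \<open>Dependence of BSE-functions on the norm\<close>

text \<open>If \<open>n\<close> is at most \<open>K\<close> times \<open>n'\<close>, the dual norm
  for \<open>n'\<close> is at most \<open>K\<close> times that for \<open>n\<close>, so a BSE
  constant \<open>C\<close> becomes \<open>C * K\<close>. Boundedness of the characters for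
  \<open>n\<close> makes the dual norms of their combinations genuine suprema.\<close>

lemma BSE_functions_subset:
  assumes X: "banach_algebra_on X n" "banach_algebra_on X n'"
    and le: "K > 0" "\<And>x. x \<in> X \<Longrightarrow> n x \<le> K * n' x"
    and bdd: "\<And>\<phi> x. \<phi> \<in> characters X \<Longrightarrow> x \<in> X \<Longrightarrow> cmod (\<phi> x) \<le> L * n x"
  shows "BSE_functions X n' \<subseteq> BSE_functions X n"
proof
  fix \<sigma> assume "\<sigma> \<in> BSE_functions X n'"
  then obtain C where \<sigma>: "\<sigma> \<in> bounded_continuous_on_characters X" and C: "C > 0"
    and bound: "\<And>(m::nat) \<phi> c. (\<forall>i<m. \<phi> i \<in> characters X) \<Longrightarrow>
       cmod (\<Sum>i<m. c i * \<sigma> (\<phi> i)) \<le> C * dual_norm X n' (\<lambda>x. \<Sum>i<m. c i * \<phi> i x)"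
    by (auto simp: BSE_functions_def)
  have "cmod (\<Sum>i<m. c i * \<sigma> (\<phi> i)) \<le> C * K * dual_norm X n (\<lambda>x. \<Sum>i<m. c i * \<phi> i x)"
    if \<phi>: "\<forall>i<m. \<phi> i \<in> characters X" for m :: nat and \<phi> c
  proof -
    let ?f = "\<lambda>x. \<Sum>i<m. c i * \<phi> i x"
    have f: "cmod (?f x) \<le> (\<Sum>i<m. cmod (c i) * L) * n x" if "x \<in> X" for x
      unfolding sum_distrib_right
      using \<phi> bdd that by (intro sum_norm_le) (auto simp: norm_mult mult.assoc mult_left_mono)
    have pos: "0 \<le> dual_norm X n ?f"
      by (rule dual_norm_nonneg[OF X(1)]) (rule f)
    have "cmod (?f x) \<le> K * dual_norm X n ?f * n' x" if x: "x \<in> X" for x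
    proof -
      have "cmod (?f x) \<le> dual_norm X n ?f * n x"
        by (rule dual_norm_bound[OF X(1) _ x]) (rule f)
      also have "\<dots> \<le> dual_norm X n ?f * (K * n' x)"
        using le(2)[OF x] pos by (rule mult_left_mono)
      finally show ?thesis by (simp add: ac_simps)
    qed
    then have "dual_norm X n' ?f \<le> K * dual_norm X n ?f"
      using pos le(1) by (intro dual_norm_least[OF X(2)]) auto
    then have "C * dual_norm X n' ?f \<le> C * K * dual_norm X n ?f"
      using C by simp
    then show ?thesis using bound[OF \<phi>] order_trans by blast
  qed
  moreover have "C * K > 0" using C le(1) by simp
  ultimately show "\<sigma> \<in> BSE_functions X n"
    unfolding BSE_functions_def using \<sigma> by blast
qed

section \<open>Characters and the dual\<close>

text \<open>Automatic continuity of characters. Otherwise some z has norm below 1 and \<phi>(z) = 1;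
  the geometric series w of its powers satisfies w = z + z w, and applying \<phi> gives a
  contradiction.\<close>

lemma character_norm_le:
  fixes \<phi> :: "'a::complex_banach_algebra \<Rightarrow> complex"
  assumes \<phi>: "\<phi> \<in> characters UNIV"
  shows "cmod (\<phi> x) \<le> norm x"
proof (rule ccontr)
  assume "\<not> cmod (\<phi> x) \<le> norm x"
  then have less: "norm x < cmod (\<phi> x)" and nz: "\<phi> x \<noteq> 0"
    using norm_ge_zero[of x] by (auto simp: not_le)
  define z where "z = inverse (\<phi> x) *\<^sub>C x"
  have z1: "\<phi> z = 1"
    using \<phi> nz by (simp add: z_def characters_def)
  have "norm z = norm x / cmod (\<phi> x)"
    by (simp add: z_def norm_scaleC norm_inverse divide_inverse mult.commute)
  then have z: "norm z < 1"
    using less nz by simp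
  \<comment> \<open>There is no unit, so the powers start at the first: \<open>pw i\<close> is the
    power of \<open>z\<close> with exponent i + 1.\<close>
  define pw where "pw = rec_nat z (\<lambda>_ y. z * y)"
  have pw: "pw 0 = z" "pw (Suc i) = z * pw i" for i
    by (simp_all add: pw_def)
  have le: "norm (pw i) \<le> norm z ^ Suc i" for i
  proof (induction i)
    case (Suc i)
    have "norm (pw (Suc i)) \<le> norm z * norm (pw i)"
      by (simp add: pw norm_mult_ineq)
    also have "\<dots> \<le> norm z * norm z ^ Suc i"
      using Suc by (rule mult_left_mono) simp
    finally show ?case by simp
  qed (simp add: pw)
  have "summable (\<lambda>i. norm z ^ Suc i)"
    using z by (simp add: summable_geometric summable_mult)
  then have sum: "summable pw"
    using le by (rule summable_comparison_test')
  \<comment> \<open>\<open>w = z + z\<^sup>2 + \<dots>\<close>\<close>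
  define w where "w = suminf pw"
  have "z * w = (\<Sum>i. pw (Suc i))"
    unfolding w_def pw(2) by (rule suminf_mult[OF sum, symmetric])
  then have "z * w = w - z"
    by (simp only: suminf_split_head[OF sum] w_def pw(1))
  then have "z + z * w = w"
    by simp
  moreover have "\<phi> (z + z * w) = \<phi> z + \<phi> z * \<phi> w"
    using \<phi> by (simp add: characters_def)
  ultimately have "\<phi> w = 1 + \<phi> w"
    by (simp only: z1 mult_1)
  then show False by simp
qed

lemma character_in_cdual:
  assumes \<phi>: "\<phi> \<in> characters UNIV"
  shows "\<phi> \<in> cdual"
proof -
  have "bounded_linear \<phi>"
  proof (rule bounded_linear_intro[where K = 1])
    show "\<phi> (r *\<^sub>R x) = r *\<^sub>R \<phi> x" for r x
      using \<phi> by (simp add: characters_def scaleR_scaleC scaleR_conv_of_real)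
  qed (use \<phi> character_norm_le[OF \<phi>] in \<open>auto simp: characters_def\<close>)
  then show ?thesis using \<phi> by (simp add: cdual_def characters_def)
qed

lemma cdual_bounded_linear: "f \<in> cdual \<Longrightarrow> bounded_linear f"
  by (simp add: cdual_def)

lemma cdual_mult_left: "f \<in> cdual \<Longrightarrow> (\<lambda>b. f (a * b)) \<in> cdual"
  by (auto simp: cdual_def mult_scaleC_right
      intro: bounded_linear_compose[OF _ bounded_linear_mult_right])

lemma cdual_mult_right: "f \<in> cdual \<Longrightarrow> (\<lambda>b. f (b * a)) \<in> cdual"
  by (auto simp: cdual_def mult_scaleC_left
      intro: bounded_linear_compose[OF _ bounded_linear_mult_left])

lemma module_fun: "module (\<lambda>c f x. c * f x :: 'a::comm_ring_1)"
  by unfold_locales (auto simp: fun_eq_iff algebra_simps)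

lemma subspace_cdual: "module.subspace (\<lambda>c f x. c * f x) cdual"
  unfolding module.subspace_def[OF module_fun]
  by (auto simp: cdual_def plus_fun_def zero_fun_def distrib_left bounded_linear_zero
      intro: bounded_linear_add bounded_linear_const_mult)

text \<open>The point is that the restriction is nonzero: \<phi> is continuous and B is
  dense.\<close>

lemma character_restrict:
  fixes B :: "'a::complex_banach_algebra set"
  assumes B: "banach_algebra_on B n" "closure B = UNIV" and \<phi>: "\<phi> \<in> characters UNIV"
  shows "restrict \<phi> B \<in> characters B"
proof -
  have "\<exists>x\<in>B. \<phi> x \<noteq> 0"
  proof (rule ccontr)
    assume "\<not> (\<exists>x\<in>B. \<phi> x \<noteq> 0)"
    then have "\<phi> x = 0" for x
      using continuous_constant_on_closure[of B \<phi> 0 x] B(2)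
        linear_continuous_on[OF cdual_bounded_linear[OF character_in_cdual[OF \<phi>]]] by auto
    then show False using \<phi> by (simp add: characters_def)
  qed
  then show ?thesis
    using \<phi> carrier_add[OF B(1)] carrier_scaleC[OF B(1)] carrier_mult[OF B(1)]
    by (auto simp: characters_def)
qed

section \<open>Comparison of complete norms\<close>

text \<open>The open mapping theorem for the identity, by Baire category and successive approximation.\<close>

lemma complete_norm_le:
  fixes n :: "'a::complex_banach_algebra \<Rightarrow> real"
  assumes n: "banach_algebra_on UNIV n" and M: "\<And>x. norm x \<le> M * n x"
  shows "\<exists>K>0. \<forall>x. n x \<le> K * norm x"
proof -
  have n_scaleR: "n (r *\<^sub>R x) = \<bar>r\<bar> * n x" for r x
    by (simp add: scaleR_scaleC carrier_norm_scaleC[OF n])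
  define D where "D k = {x. n x \<le> real k}" for k
  \<comment> \<open>The sets \<open>D k\<close> exhaust the space, which is complete and so not a
    countable union of closed sets with empty interior.\<close>
  have "\<exists>k. interior (closure (D k)) \<noteq> {}"
  proof (rule ccontr)
    assume "\<nexists>k. interior (closure (D k)) \<noteq> {}"
    then have "interior (\<Union>(range (\<lambda>k. closure (D k)))) = {}"
      using Baire_category_alt[of euclidean "range (\<lambda>k. closure (D k))"]
        completely_metrizable_space_euclidean by auto
    moreover have "x \<in> \<Union>(range (\<lambda>k. closure (D k)))" for x
      using real_arch_simple[of "n x"] closure_subset by (fastforce simp: D_def)
    then have "\<Union>(range (\<lambda>k. closure (D k))) = UNIV" by blast
    ultimately show False by simp
  qed
  then obtain k x0 r where r: "r > 0" "ball x0 r \<subseteq> closure (D k)"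
    by (auto simp: set_eq_iff mem_interior)
  \<comment> \<open>Subtracting an approximation of \<open>x0\<close> from one of
    \<open>x0 + x\<close> moves the ball to the origin and doubles the bound
    \<open>k\<close>.\<close>
  have approx0: "\<exists>y. n y \<le> 2 * real k \<and> norm (x - y) < e" if "norm x < r" "e > 0" for x e
  proof -
    have "x0 \<in> closure (D k)" "x0 + x \<in> closure (D k)"
      using r that by (auto simp: dist_norm subset_iff)
    then obtain u v where uv: "u \<in> D k" "dist u x0 < e / 2" "v \<in> D k" "dist v (x0 + x) < e / 2"
      using \<open>e > 0\<close> unfolding closure_approachable by (meson half_gt_zero)
    have "n (v - u) \<le> 2 * real k"
      using carrier_norm_diff[OF n, of v u] uv by (simp add: D_def)
    moreover have "norm (x - (v - u)) \<le> norm (u - x0) + norm (v - (x0 + x))"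
      using norm_triangle_ineq4[of "u - x0" "v - (x0 + x)"] by (simp add: algebra_simps)
    ultimately show ?thesis
      using uv by (intro exI[of _ "v - u"]) (auto simp: dist_norm)
  qed
  \<comment> \<open>Scaling a nonzero \<open>x\<close> to norm r/2 multiplies it by r / (2 ||x||);
    undoing this turns the bound 2k into (4k / r) ||x||.\<close>
  define L where "L = 4 * real k / r"
  have L: "0 \<le> L" using r by (simp add: L_def)
  have approx: "\<exists>y. n y \<le> L * norm x \<and> norm (x - y) < e" if e: "e > 0" for x e
  proof (cases "x = 0")
    case True
    then show ?thesis
      using e carrier_norm_eq_0[OF n, of 0] by (intro exI[of _ 0]) simp
  next
    case False
    define c where "c = r / (2 * norm x)"
    have c: "c > 0" using False r by (simp add: c_def)
    have "norm (c *\<^sub>R x) < r" using False r by (simp add: c_def)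
    then obtain y where y: "n y \<le> 2 * real k" "norm (c *\<^sub>R x - y) < c * e"
      using approx0[of "c *\<^sub>R x" "c * e"] c e by auto
    have "n (inverse c *\<^sub>R y) \<le> inverse c * (2 * real k)"
      using y c by (simp add: n_scaleR)
    also have "\<dots> = L * norm x"
      using False r by (simp add: L_def c_def field_simps)
    finally have "n (inverse c *\<^sub>R y) \<le> L * norm x" .
    moreover have "norm (x - inverse c *\<^sub>R y) < e"
    proof -
      have "x - inverse c *\<^sub>R y = inverse c *\<^sub>R (c *\<^sub>R x - y)"
        using c by (simp add: scaleR_diff_right)
      then have "norm (x - inverse c *\<^sub>R y) = inverse c * norm (c *\<^sub>R x - y)"
        using c by simp
      then show ?thesis
        using y c by (simp add: inverse_eq_divide pos_divide_less_eq mult.commute)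
    qed
    ultimately show ?thesis by blast
  qed
  have "n x \<le> 2 * L * norm x" for x
  proof (cases "x = 0")
    case True
    then show ?thesis using carrier_norm_eq_0[OF n, of 0] by simp
  next
    case False
    define pick where "pick y e = (SOME z. n z \<le> L * norm y \<and> norm (y - z) < e)" for y and e :: real
    have pick: "n (pick y e) \<le> L * norm y" "norm (y - pick y e) < e" if "e > 0" for y e
      using someI_ex[OF approx[OF that, of y]] by (auto simp: pick_def)
    \<comment> \<open>\<open>R j\<close> is what is left of \<open>x\<close> after j approximations.
      The tolerances halve, so the j-th correction has \<open>n\<close>-norm at most L ||x|| / 2^j,
      and the geometric series sums to 2 L ||x||.\<close>
    define R where "R = rec_nat x (\<lambda>j y. y - pick y (norm x / 2 ^ Suc j))"
    have R: "R 0 = x" "R (Suc j) = R j - pick (R j) (norm x / 2 ^ Suc j)" for j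
      by (simp_all add: R_def)
    have R_le: "norm (R j) \<le> norm x / 2 ^ j" for j
    proof (cases j)
      case (Suc i)
      then show ?thesis using pick(2)[of "norm x / 2 ^ Suc i" "R i"] False by (simp add: R)
    qed (simp add: R)
    have step: "n (R j - R (Suc j)) \<le> L * (norm x / 2 ^ j)" for j
    proof -
      have "n (R j - R (Suc j)) \<le> L * norm (R j)"
        using pick(1)[of "norm x / 2 ^ Suc j" "R j"] False by (simp add: R)
      then show ?thesis
        using mult_left_mono[OF R_le[of j] L] by linarith
    qed
    have tail: "n (R i - R (i + j)) \<le> 2 * L * norm x * (1 / 2 ^ i - 1 / 2 ^ (i + j))" for i j
    proof (induction j)
      case 0
      then show ?case using carrier_norm_eq_0[OF n, of 0] by simp
    next
      case (Suc j)
      have "n (R i - R (i + Suc j)) \<le> n (R i - R (i + j)) + n (R (i + j) - R (Suc (i + j)))"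
        using carrier_norm_add[OF n, of "R i - R (i + j)" "R (i + j) - R (Suc (i + j))"] by simp
      also have "\<dots> \<le> 2 * L * norm x * (1 / 2 ^ i - 1 / 2 ^ (i + j)) + L * (norm x / 2 ^ (i + j))"
        using Suc step by (intro add_mono)
      also have "\<dots> = 2 * L * norm x * (1 / 2 ^ i - 1 / 2 ^ (i + Suc j))"
        by (simp add: field_simps)
      finally show ?case .
    qed
    have tail': "n (R i - R j) \<le> 2 * L * norm x / 2 ^ i" if "i \<le> j" for i j
    proof -
      have "2 * L * norm x * (1 / 2 ^ i - 1 / 2 ^ j) \<le> 2 * L * norm x * (1 / 2 ^ i)"
        using L by (intro mult_left_mono) auto
      then show ?thesis using tail[of i "j - i"] that by simp
    qed
    have Cauchy: "\<exists>N. \<forall>i\<ge>N. \<forall>j\<ge>N. n ((x - R i) - (x - R j)) < e" if e: "e > 0" for e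
    proof -
      have "(\<lambda>N. 2 * L * norm x * (1 / 2) ^ N) \<longlonglongrightarrow> 0"
        using tendsto_mult_left[OF LIMSEQ_power_zero[of "1/2::real"], of "2 * L * norm x"] by simp
      then obtain N where N: "2 * L * norm x * (1 / 2) ^ N < e"
        using order_tendstoD(2)[OF _ e] eventually_happens'[OF sequentially_bot] by blast
      have lt: "n (R i - R j) < e" if "N \<le> i" "i \<le> j" for i j
      proof -
        have "2 * L * norm x * (1 / 2) ^ i \<le> 2 * L * norm x * (1 / 2) ^ N"
          using L that by (intro mult_left_mono power_decreasing) auto
        then show ?thesis using tail'[OF that(2)] N by (simp add: power_one_over)
      qed
      then have "n ((x - R i) - (x - R j)) < e" if ij: "N \<le> i" "N \<le> j" for i j
        using lt[OF ij(1), of j] lt[OF ij(2), of i] linear[of i j]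
          carrier_norm_diff_commute[OF n, of "R i" "R j"] by auto
      then show ?thesis by blast
    qed
    then obtain z where z: "(\<lambda>i. n ((x - R i) - z)) \<longlonglongrightarrow> 0"
      using carrier_complete[OF n, of "\<lambda>i. x - R i"] by auto
    \<comment> \<open>As \<open>n\<close> dominates the norm, the \<open>n\<close>-limit
      \<open>z\<close> of the partial sums is also their norm limit, which is
      \<open>x\<close>.\<close>
    have "(\<lambda>i. M * n ((x - R i) - z)) \<longlonglongrightarrow> 0"
      using tendsto_mult_left[OF z, of M] by simp
    then have "(\<lambda>i. (x - R i) - z) \<longlonglongrightarrow> 0"
      by (rule Lim_null_comparison[rotated]) (simp add: M)
    moreover have "R \<longlonglongrightarrow> 0"
    proof (rule Lim_null_comparison)
      show "(\<lambda>j. norm x / 2 ^ j) \<longlonglongrightarrow> 0"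
        using tendsto_mult_left[OF LIMSEQ_power_zero[of "1/2::real"], of "norm x"]
        by (simp add: power_one_over)
    qed (simp add: R_le)
    ultimately have "(\<lambda>i. x - z) \<longlonglongrightarrow> 0"
      using tendsto_add by fastforce
    then have "z = x" by (simp add: LIMSEQ_const_iff)
    have "n x \<le> 2 * L * norm x + n ((x - R i) - z)" for i
      using tail'[of 0 i] carrier_norm_diff[OF n, of "x - R i" "(x - R i) - x"] \<open>z = x\<close>
      by (simp add: R)
    moreover have "(\<lambda>i. 2 * L * norm x + n ((x - R i) - z)) \<longlonglongrightarrow> 2 * L * norm x + 0"
      using z by (intro tendsto_add tendsto_const)
    ultimately show ?thesis
      using LIMSEQ_le_const by fastforce
  qed
  \<comment> \<open>The constant must be positive, while \<open>L\<close> is 0 if k = 0.\<close>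
  moreover have "2 * L * norm x \<le> (2 * L + 1) * norm x" for x :: 'a
    by (simp add: distrib_right)
  ultimately have "\<forall>x. n x \<le> (2 * L + 1) * norm x" using order_trans by blast
  then show ?thesis using L by (intro exI[of _ "2 * L + 1"]) auto
qed

text \<open>Characters, their topology and multipliers depend on the algebra alone. Apart from the
  norm axioms, only the BSE-functions see the norm, and equivalent norms give the same ones.\<close>

lemma BSE_algebra_norm_cong:
  fixes n :: "'a::complex_banach_algebra \<Rightarrow> real"
  assumes n: "banach_algebra_on UNIV n"
    and M: "M > 0" "\<And>x. norm x \<le> M * n x" and K: "K > 0" "\<And>x. n x \<le> K * norm x"
  shows "BSE_algebra (UNIV :: 'a set) n \<longleftrightarrow> BSE_algebra (UNIV :: 'a set) norm"
proof -
  have "cmod (\<phi> x) \<le> M * n x" if "\<phi> \<in> characters UNIV" for \<phi> x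
    using character_norm_le[OF that, of x] M(2)[of x] by linarith
  then have "BSE_functions (UNIV :: 'a set) norm \<subseteq> BSE_functions UNIV n"
    by (intro BSE_functions_subset[OF n banach_algebra_on_UNIV K]) auto
  moreover have "BSE_functions (UNIV :: 'a set) n \<subseteq> BSE_functions UNIV norm"
    using character_norm_le
    by (intro BSE_functions_subset[OF banach_algebra_on_UNIV n M, where L = 1]) auto
  ultimately show ?thesis
    unfolding BSE_algebra_def using n banach_algebra_on_UNIV by blast
qed

section \<open>Abstract Segal algebras\<close>

text \<open>The definition gives the inequality for \<open>a\<close> in B only. For general
  \<open>a\<close>, approximate by s i in B: the products s i * b are Cauchy for \<open>nB\<close>,
  and their \<open>nB\<close>-limit is \<open>a * b\<close> because \<open>nB\<close> dominates the
  norm.\<close>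

lemma segal_norm_mult_le:
  fixes B :: "'a::complex_banach_algebra set"
  assumes B: "abstract_segal_algebra B nB"
  shows "\<exists>C>0. \<forall>a. \<forall>b\<in>B. nB (a * b) \<le> C * norm a * nB b"
proof -
  from B obtain M C where ban: "banach_algebra_on B nB" and dense: "closure B = UNIV"
    and ideal: "\<And>a b. b \<in> B \<Longrightarrow> a * b \<in> B"
    and M: "\<And>b. b \<in> B \<Longrightarrow> norm b \<le> M * nB b"
    and C: "C > 0" "\<And>a b. a \<in> B \<Longrightarrow> b \<in> B \<Longrightarrow> nB (a * b) \<le> C * norm a * nB b"
    unfolding abstract_segal_algebra_def by blast
  have "nB (a * b) \<le> C * norm a * nB b" if b: "b \<in> B" for a b
  proof -
    obtain s where s: "\<And>i. s i \<in> B" "s \<longlonglongrightarrow> a"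
      using dense closure_sequential[of a B] by auto
    have "\<exists>N. \<forall>i\<ge>N. \<forall>j\<ge>N. nB (s i * b - s j * b) < e" if e: "e > 0" for e
    proof -
      \<comment> \<open>The summand 1 keeps the denominator positive when \<open>nB b\<close> is
        0.\<close>
      define d where "d = e / (C * (nB b + 1))"
      have nb: "0 \<le> nB b" using carrier_norm_nonneg[OF ban b] .
      then have d: "d > 0" using C(1) e by (simp add: d_def)
      obtain N where N: "\<forall>i\<ge>N. \<forall>j\<ge>N. norm (s i - s j) < d"
        using LIMSEQ_imp_Cauchy[OF s(2)] d by (auto simp: Cauchy_def dist_norm)
      have "nB (s i * b - s j * b) < e" if "N \<le> i" "N \<le> j" for i j
      proof -
        have "nB (s i * b - s j * b) \<le> C * norm (s i - s j) * nB b"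
          using C(2)[OF carrier_diff[OF ban s(1) s(1)] b] by (simp add: left_diff_distrib)
        also have "\<dots> \<le> C * norm (s i - s j) * (nB b + 1)"
          using C(1) by (intro mult_left_mono) auto
        also have "\<dots> < C * d * (nB b + 1)"
          using C(1) nb N that by (intro mult_strict_right_mono mult_strict_left_mono) auto
        also have "\<dots> = e"
          using C(1) nb by (simp add: d_def)
        finally show ?thesis .
      qed
      then show ?thesis by blast
    qed
    then obtain y where y: "y \<in> B" "(\<lambda>i. nB (s i * b - y)) \<longlonglongrightarrow> 0"
      using carrier_complete[OF ban, of "\<lambda>i. s i * b"] ideal[OF b] by blast
    have "(\<lambda>i. M * nB (s i * b - y)) \<longlonglongrightarrow> 0"
      using tendsto_mult_left[OF y(2), of M] by simp
    then have "(\<lambda>i. s i * b - y) \<longlonglongrightarrow> 0"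
      by (rule Lim_null_comparison[rotated]) (simp add: M carrier_diff[OF ban] ideal[OF b] y)
    then have "(\<lambda>i. s i * b) \<longlonglongrightarrow> y" by (simp add: LIM_zero_iff)
    moreover have "(\<lambda>i. s i * b) \<longlonglongrightarrow> a * b"
      using s(2) by (intro tendsto_mult tendsto_const)
    ultimately have y_eq: "y = a * b" by (rule LIMSEQ_unique)
    have "nB (a * b) \<le> C * norm (s i) * nB b + nB (s i * b - y)" for i
      using carrier_norm_diff[OF ban, of "s i * b" "s i * b - y"] C(2)[OF s(1) b, of i]
        carrier_diff[OF ban] ideal[OF b] y(1) by (simp add: y_eq)
    moreover have "(\<lambda>i. C * norm (s i) * nB b + nB (s i * b - y)) \<longlonglongrightarrow> C * norm a * nB b + 0"
      using s(2) y(2) by (intro tendsto_intros)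
    ultimately show ?thesis
      using LIMSEQ_le_const by fastforce
  qed
  then show ?thesis using C(1) by blast
qed

lemma segal_eq_UNIV:
  fixes B :: "'a::complex_banach_algebra set"
  assumes B: "abstract_segal_algebra B nB" and K: "K > 0" "\<And>b. b \<in> B \<Longrightarrow> nB b \<le> K * norm b"
  shows "B = UNIV"
proof -
  from B obtain M where ban: "banach_algebra_on B nB" and dense: "closure B = UNIV"
    and M: "\<And>b. b \<in> B \<Longrightarrow> norm b \<le> M * nB b"
    unfolding abstract_segal_algebra_def by blast
  have "x \<in> B" for x
  proof -
    obtain s where s: "\<And>i. s i \<in> B" "s \<longlonglongrightarrow> x"
      using dense closure_sequential[of x B] by auto
    have "\<exists>N. \<forall>i\<ge>N. \<forall>j\<ge>N. nB (s i - s j) < e" if e: "e > 0" for e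
    proof -
      obtain N where N: "\<forall>i\<ge>N. \<forall>j\<ge>N. norm (s i - s j) < e / K"
        using LIMSEQ_imp_Cauchy[OF s(2)] divide_pos_pos[OF e K(1)]
        unfolding Cauchy_def dist_norm by blast
      have "nB (s i - s j) < e" if "N \<le> i" "N \<le> j" for i j
      proof -
        have "K * norm (s i - s j) < K * (e / K)"
          using N that K(1) by (intro mult_strict_left_mono) auto
        then show ?thesis
          using K(2)[OF carrier_diff[OF ban s(1) s(1)], of i j] K(1) by simp
      qed
      then show ?thesis by blast
    qed
    then obtain y where y: "y \<in> B" "(\<lambda>i. nB (s i - y)) \<longlonglongrightarrow> 0"
      using carrier_complete[OF ban, of s] s(1) by blast
    have "(\<lambda>i. M * nB (s i - y)) \<longlonglongrightarrow> 0"
      using tendsto_mult_left[OF y(2), of M] by simp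
    then have "(\<lambda>i. s i - y) \<longlonglongrightarrow> 0"
      by (rule Lim_null_comparison[rotated]) (simp add: M carrier_diff[OF ban] s y)
    then have "s \<longlonglongrightarrow> y" by (simp add: LIM_zero_iff)
    then show ?thesis using s(2) y(1) LIMSEQ_unique by blast
  qed
  then show ?thesis by blast
qed

section \<open>A functional on the dual of A that is 1 on every character\<close>

lemma sum_lessThan_add:
  fixes f :: "nat \<Rightarrow> 'b::comm_monoid_add"
  shows "sum f {..<m + k} = sum f {..<m} + (\<Sum>i<k. f (m + i))"
  by (induction k) (simp_all add: add.assoc)

text \<open>
  The transform of the identity multiplier is the constant \<open>1\<close>; as it is a BSE-function, sending
  each character to \<open>1\<close> is well defined and dominated on the span of the characters.
\<close>

lemma BSE_bidual_unit:
  fixes B :: "'a::complex_banach_algebra set"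
  assumes B: "abstract_segal_algebra B nB" and BSE: "BSE_algebra B nB"
  obtains C F where "C > 0"
    "\<And>f g. f \<in> cdual \<Longrightarrow> g \<in> cdual \<Longrightarrow> F (\<lambda>x. f x + g x) = F f + F g"
    "\<And>c f. f \<in> cdual \<Longrightarrow> F (\<lambda>x. c * f x) = c * F f"
    "\<And>f. f \<in> cdual \<Longrightarrow> cmod (F f) \<le> C * dual_norm B nB f"
    "\<And>\<phi>. \<phi> \<in> characters (UNIV :: 'a set) \<Longrightarrow> F \<phi> = 1"
proof -
  from B obtain M where ban: "banach_algebra_on B nB" and dense: "closure B = UNIV"
    and M: "M > 0" "\<And>b. b \<in> B \<Longrightarrow> norm b \<le> M * nB b"
    by (auto simp: abstract_segal_algebra_def)
  define \<sigma> where "\<sigma> = restrict (\<lambda>_. 1 :: complex) (characters B)"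
  have "is_multiplier_transform B (restrict id B) \<sigma>"
    by (auto simp: is_multiplier_transform_def bounded_continuous_on_characters_def \<sigma>_def
        intro: bounded_subset[of "{1}"] continuous_on_eq[OF continuous_on_const])
  moreover have "restrict id B \<in> multipliers B"
    by (auto simp: multipliers_def carrier_add[OF ban] carrier_scaleC[OF ban])
  ultimately have "\<sigma> \<in> BSE_functions B nB"
    using BSE by (auto simp: BSE_algebra_def multiplier_transforms_def)
  then obtain C where C: "C > 0"
    and bound: "\<And>(m::nat) \<phi> c. (\<forall>i<m. \<phi> i \<in> characters B) \<Longrightarrow>
       cmod (\<Sum>i<m. c i * \<sigma> (\<phi> i)) \<le> C * dual_norm B nB (\<lambda>x. \<Sum>i<m. c i * \<phi> i x)"
    by (auto simp: BSE_functions_def)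
  have cdual_bound: "cmod (f x) \<le> onorm f * M * nB x" if "f \<in> cdual" "x \<in> B" for f x
  proof -
    have "cmod (f x) \<le> onorm f * norm x"
      using that by (intro onorm cdual_bounded_linear)
    also have "\<dots> \<le> onorm f * (M * nB x)"
      using that M(2) by (intro mult_left_mono onorm_pos_le cdual_bounded_linear) auto
    finally show ?thesis by (simp add: mult.assoc)
  qed
  define p where "p f = C * dual_norm B nB f" for f
  \<comment> \<open>One combination of characters may have several representations; that they share
    the same coefficient sum comes from the domination by \<open>p\<close>.\<close>
  define G where "G = {((\<lambda>x. \<Sum>i<m. c i * \<phi> i x), \<Sum>i<m. c i) |(m::nat) c \<phi>.
    \<forall>i<m. \<phi> i \<in> characters (UNIV :: 'a set)}"
  have G_intro: "((\<lambda>x. \<Sum>i<m. c i * \<phi> i x), \<Sum>i<m. c i) \<in> G"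
    if "\<forall>i<m. \<phi> i \<in> characters UNIV" for m :: nat and c \<phi>
    using that unfolding G_def by blast
  have lin: "linear_graph (\<lambda>c f x. c * f x) G"
    unfolding linear_graph_def
  proof (intro conjI allI impI)
    show "(0, 0) \<in> G" using G_intro[of 0] by (simp add: zero_fun_def)
  next
    fix v t w u assume "(v, t) \<in> G" "(w, u) \<in> G"
    then obtain m :: nat and c \<phi> and k :: nat and d \<psi> where
      v: "v = (\<lambda>x. \<Sum>i<m. c i * \<phi> i x)" "t = (\<Sum>i<m. c i)" "\<forall>i<m. \<phi> i \<in> characters UNIV" and
      w: "w = (\<lambda>x. \<Sum>i<k. d i * \<psi> i x)" "u = (\<Sum>i<k. d i)" "\<forall>i<k. \<psi> i \<in> characters UNIV"
      unfolding G_def by blast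
    \<comment> \<open>Concatenation of the two families, the second shifted by
      \<open>m\<close>.\<close>
    define e where "e i = (if i < m then c i else d (i - m))" for i
    define \<theta> where "\<theta> i = (if i < m then \<phi> i else \<psi> (i - m))" for i
    have "v + w = (\<lambda>x. \<Sum>i<m + k. e i * \<theta> i x)" "t + u = (\<Sum>i<m + k. e i)"
      by (simp_all add: v w sum_lessThan_add e_def \<theta>_def plus_fun_def)
    moreover have "\<forall>i<m + k. \<theta> i \<in> characters UNIV"
      using v w by (auto simp: \<theta>_def)
    ultimately show "(v + w, t + u) \<in> G"
      using G_intro by simp
  next
    fix a v t assume "(v, t) \<in> G"
    then obtain m :: nat and c \<phi> where
      v: "v = (\<lambda>x. \<Sum>i<m. c i * \<phi> i x)" "t = (\<Sum>i<m. c i)" "\<forall>i<m. \<phi> i \<in> characters UNIV"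
      unfolding G_def by blast
    have "(\<lambda>x. a * v x) = (\<lambda>x. \<Sum>i<m. (a * c i) * \<phi> i x)" "a * t = (\<Sum>i<m. a * c i)"
      by (simp_all add: v sum_distrib_left mult.assoc)
    then show "(\<lambda>x. a * v x, a * t) \<in> G"
      using G_intro[OF v(3)] by simp
  qed
  have cdual_sum: "(\<lambda>x. \<Sum>i<m. c i * \<phi> i x) \<in> cdual"
    if "\<forall>i<m. \<phi> i \<in> characters UNIV" for m :: nat and c and \<phi> :: "nat \<Rightarrow> 'a \<Rightarrow> complex"
    using that
  proof (induction m)
    case 0
    then show ?case
      using module.subspace_0[OF module_fun subspace_cdual] by (simp add: zero_fun_def)
  next
    case (Suc m)
    have "(\<lambda>x. c m * \<phi> m x) \<in> cdual"
      using Suc.prems by (intro module.subspace_scale[OF module_fun subspace_cdual] character_in_cdual) auto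
    then show ?case
      using module.subspace_add[OF module_fun subspace_cdual Suc.IH] Suc.prems
      by (simp add: plus_fun_def)
  qed
  have G_cdual: "G \<subseteq> cdual \<times> UNIV"
    using cdual_sum by (auto simp: G_def)
  have G_le: "cmod t \<le> p v" if "(v, t) \<in> G" for v t
  proof -
    from that obtain m :: nat and c \<phi> where
      v: "v = (\<lambda>x. \<Sum>i<m. c i * \<phi> i x)" "t = (\<Sum>i<m. c i)" "\<forall>i<m. \<phi> i \<in> characters UNIV"
      unfolding G_def by blast
    \<comment> \<open>The BSE inequality concerns characters of B, so characters of A enter through
      their restrictions.\<close>
    have res: "\<forall>i<m. restrict (\<phi> i) B \<in> characters B"
      using v(3) character_restrict[OF ban dense] by blast
    have "(\<Sum>i<m. c i * \<sigma> (restrict (\<phi> i) B)) = t"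
      using res by (simp add: v \<sigma>_def)
    moreover have "dual_norm B nB (\<lambda>x. \<Sum>i<m. c i * restrict (\<phi> i) B x) = dual_norm B nB v"
      by (simp add: dual_norm_def v)
    ultimately show ?thesis
      using bound[OF res, of c] by (simp add: p_def)
  qed
  have p_add: "p (f + g) \<le> p f + p g" if "f \<in> cdual" "g \<in> cdual" for f g
    using dual_norm_add[OF ban, of f "onorm f * M" g "onorm g * M"] cdual_bound that C
    by (simp add: p_def plus_fun_def flip: distrib_left)
  have p_scale: "p (\<lambda>x. c * f x) = cmod c * p f" if "f \<in> cdual" for c f
    using dual_norm_mult[OF ban, of f "onorm f * M" c] cdual_bound that
    by (simp add: p_def)
  obtain F where F: "\<And>f g. f \<in> cdual \<Longrightarrow> g \<in> cdual \<Longrightarrow> F (f + g) = F f + F g"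
    "\<And>c f. f \<in> cdual \<Longrightarrow> F (\<lambda>x. c * f x) = c * F f"
    "\<And>f. f \<in> cdual \<Longrightarrow> cmod (F f) \<le> p f" "\<And>f t. (f, t) \<in> G \<Longrightarrow> F f = t"
    using complex_Hahn_Banach[of "\<lambda>c f x. c * f x" cdual p G,
        OF module_fun subspace_cdual p_add p_scale lin G_cdual G_le] by blast
  have "F \<phi> = 1" if "\<phi> \<in> characters UNIV" for \<phi>
    using F(4) G_intro[of 1 "\<lambda>_. \<phi>" "\<lambda>_. 1"] that by simp
  then show ?thesis
    using that[OF C, of F] F by (simp add: p_def plus_fun_def)
qed

text \<open>\<open>F \<box> a\<close> lies in the algebra and has the transform of \<open>a\<close>.\<close>

lemma bidual_unit:
  fixes F :: "('a::complex_banach_algebra \<Rightarrow> complex) \<Rightarrow> complex"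
  assumes ss: "semisimple (UNIV :: 'a set)" and ideal: "ideal_in_bidual TYPE('a)"
    and F_add: "\<And>f g. f \<in> cdual \<Longrightarrow> g \<in> cdual \<Longrightarrow> F (\<lambda>x. f x + g x) = F f + F g"
    and F_scale: "\<And>c f. f \<in> cdual \<Longrightarrow> F (\<lambda>x. c * f x) = c * F f"
    and F_bound: "\<And>f. f \<in> cdual \<Longrightarrow> cmod (F f) \<le> K * onorm f"
    and F_char: "\<And>\<phi>. \<phi> \<in> characters (UNIV :: 'a set) \<Longrightarrow> F \<phi> = 1"
    and f: "f \<in> cdual"
  shows "F (\<lambda>x. f (x * a)) = f a"
proof -
  have add: "(\<lambda>x. f x + g x) \<in> cdual" if "f \<in> cdual" "g \<in> cdual" for f g :: "'a \<Rightarrow> complex"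
    using module.subspace_add[OF module_fun subspace_cdual that] by (simp add: plus_fun_def)
  have scale: "(\<lambda>x. c * f x) \<in> cdual" if "f \<in> cdual" for c and f :: "'a \<Rightarrow> complex"
    using module.subspace_scale[OF module_fun subspace_cdual that] .
  have "restrict F cdual \<in> cbidual"
    using F_add F_scale F_bound by (auto simp: cbidual_def add scale intro!: exI[of _ K])
  then obtain c where c: "arens_product (restrict F cdual) (canonical_embedding a) = canonical_embedding c"
    using ideal unfolding ideal_in_bidual_def by blast
  \<comment> \<open>The Arens product of \<open>F\<close> with \<open>a\<close>, evaluated at
    \<open>g\<close>; by the ideal property it is represented by \<open>c\<close>.\<close>
  have eq: "g c = F (\<lambda>x. g (x * a))" if g: "g \<in> cdual" for g
    using fun_cong[OF c, of g] g
    by (simp add: arens_product_def canonical_embedding_def cdual_mult_left cdual_mult_right)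
  have "\<phi> (c - a) = 0" if \<phi>: "\<phi> \<in> characters UNIV" for \<phi>
  proof -
    \<comment> \<open>On a character the shifted functional is a multiple of the character, where
      \<open>F\<close> is known. Semisimplicity then forces c = a.\<close>
    have "(\<lambda>x. \<phi> (x * a)) = (\<lambda>x. \<phi> a * \<phi> x)"
      using \<phi> by (auto simp: characters_def mult.commute)
    then have "\<phi> c = \<phi> a"
      using eq[OF character_in_cdual[OF \<phi>]] F_scale[OF character_in_cdual[OF \<phi>]] F_char[OF \<phi>]
      by simp
    then show ?thesis
      using linear_diff[OF bounded_linear.linear[OF cdual_bounded_linear[OF character_in_cdual[OF \<phi>]]]]
      by simp
  qed
  then have "c - a = 0"
    using ss unfolding semisimple_def by blast
  then show ?thesis using eq[OF f] by simp
qed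

section \<open>Domination of the Segal norm by the ambient norm\<close>

lemma essential_segal_norm_le:
  fixes B :: "'a::{complex_banach_algebra, comm_ring} set"
  assumes ss: "semisimple (UNIV :: 'a set)" and ideal: "ideal_in_bidual TYPE('a)"
    and ess: "essential_abstract_segal_algebra B nB" and BSE: "BSE_algebra B nB"
  shows "\<exists>K>0. \<forall>b\<in>B. nB b \<le> K * norm b"
proof -
  interpret module "scaleC :: complex \<Rightarrow> 'a \<Rightarrow> 'a" by (rule module_scaleC)
  have seg: "abstract_segal_algebra B nB"
    using ess by (simp add: essential_abstract_segal_algebra_def)
  then obtain M where ban: "banach_algebra_on B nB" and idB: "\<And>a b. b \<in> B \<Longrightarrow> a * b \<in> B"
    and M: "M > 0" "\<And>b. b \<in> B \<Longrightarrow> norm b \<le> M * nB b"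
    by (auto simp: abstract_segal_algebra_def)
  obtain C where C: "C > 0" "\<And>a b. b \<in> B \<Longrightarrow> nB (a * b) \<le> C * norm a * nB b"
    using segal_norm_mult_le[OF seg] by blast
  obtain L F where L: "L > 0"
    and F_add: "\<And>f g. f \<in> cdual \<Longrightarrow> g \<in> cdual \<Longrightarrow> F (\<lambda>x. f x + g x) = F f + F g"
    and F_scale: "\<And>c f. f \<in> cdual \<Longrightarrow> F (\<lambda>x. c * f x) = c * F f"
    and F_le: "\<And>f. f \<in> cdual \<Longrightarrow> cmod (F f) \<le> L * dual_norm B nB f"
    and F_char: "\<And>\<phi>. \<phi> \<in> characters (UNIV :: 'a set) \<Longrightarrow> F \<phi> = 1"
    using BSE_bidual_unit[OF seg BSE] by blast
  have F_bound: "cmod (F f) \<le> L * M * onorm f" if f: "f \<in> cdual" for f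
  proof -
    have "cmod (f x) \<le> M * onorm f * nB x" if x: "x \<in> B" for x
    proof -
      have "cmod (f x) \<le> onorm f * norm x"
        by (intro onorm cdual_bounded_linear f)
      also have "\<dots> \<le> onorm f * (M * nB x)"
        using x M(2) f by (intro mult_left_mono onorm_pos_le cdual_bounded_linear) auto
      finally show ?thesis by (simp add: ac_simps)
    qed
    then have "dual_norm B nB f \<le> M * onorm f"
      using M(1) onorm_pos_le[OF cdual_bounded_linear[OF f]] by (intro dual_norm_least[OF ban]) auto
    then have "L * dual_norm B nB f \<le> L * (M * onorm f)"
      using L by simp
    then show ?thesis using F_le[OF f] by (simp add: mult.assoc)
  qed
  have unit: "F (\<lambda>x. f (x * a)) = f a" if "f \<in> cdual" for f a
    by (rule bidual_unit[OF ss ideal F_add F_scale F_bound F_char that])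
  define S where "S = {x * y |x y. y \<in> B}"
  have span_le: "s \<in> B \<and> nB s \<le> L * C * norm s" if s: "s \<in> span S" for s
  proof -
    have "S \<subseteq> B" using idB by (auto simp: S_def)
    then have sB: "s \<in> B"
      using s span_minimal carrier_subspace[OF ban] by blast
    \<comment> \<open>The functional c s |-> c ||s||_B on the line through \<open>s\<close>; its
      extension \<open>g\<close> norms \<open>s\<close>.\<close>
    define G where "G = range (\<lambda>c. (c *\<^sub>C s, c * complex_of_real (nB s)))"
    have lin: "linear_graph scaleC G"
      unfolding linear_graph_def
    proof (intro conjI allI impI)
      show "(0, 0) \<in> G" unfolding G_def by (rule image_eqI[of _ _ 0]) auto
    next
      fix v t w u assume "(v, t) \<in> G" "(w, u) \<in> G"
      then obtain c d where "v = c *\<^sub>C s" "t = c * nB s" "w = d *\<^sub>C s" "u = d * nB s"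
        by (auto simp: G_def)
      then show "(v + w, t + u) \<in> G"
        unfolding G_def by (intro image_eqI[of _ _ "c + d"]) (auto simp: scale_left_distrib distrib_right)
    next
      fix d v t assume "(v, t) \<in> G"
      then obtain c where "v = c *\<^sub>C s" "t = c * nB s"
        by (auto simp: G_def)
      then show "(d *\<^sub>C v, d * t) \<in> G"
        unfolding G_def by (intro image_eqI[of _ _ "d * c"]) auto
    qed
    have GB: "G \<subseteq> B \<times> UNIV"
      using sB carrier_scaleC[OF ban] by (auto simp: G_def)
    have G_le: "cmod t \<le> nB v" if "(v, t) \<in> G" for v t
      using that sB carrier_norm_nonneg[OF ban]
      by (auto simp: G_def norm_mult carrier_norm_scaleC[OF ban])
    obtain g where g_add: "\<And>v w. v \<in> B \<Longrightarrow> w \<in> B \<Longrightarrow> g (v + w) = g v + g w"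
      and g_scale: "\<And>c v. v \<in> B \<Longrightarrow> g (c *\<^sub>C v) = c * g v"
      and g_le: "\<And>v. v \<in> B \<Longrightarrow> cmod (g v) \<le> nB v"
      and g_G: "\<And>v t. (v, t) \<in> G \<Longrightarrow> g v = t"
      using complex_Hahn_Banach[of scaleC B nB G, OF module_scaleC carrier_subspace[OF ban]
          carrier_norm_add[OF ban] carrier_norm_scaleC[OF ban] lin GB G_le] by blast
    have "(1 *\<^sub>C s, 1 * complex_of_real (nB s)) \<in> G" unfolding G_def by (rule rangeI)
    then have gs: "g s = complex_of_real (nB s)" using g_G by (simp add: scaleC_one)
    have g_cdual: "(\<lambda>x. g (x * b)) \<in> cdual" if b: "b \<in> B" for b
    proof -
      have "bounded_linear (\<lambda>x. g (x * b))"
      proof (rule bounded_linear_intro[where K = "C * nB b"])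
        show "g ((x + y) * b) = g (x * b) + g (y * b)" for x y
          using idB[OF b] by (simp add: distrib_right g_add)
        show "g ((r *\<^sub>R x) * b) = r *\<^sub>R g (x * b)" for r x
          using idB[OF b] by (simp add: scaleR_scaleC mult_scaleC_left g_scale scaleR_conv_of_real)
        show "cmod (g (x * b)) \<le> norm x * (C * nB b)" for x
          using g_le[OF idB[OF b], of x] C(2)[OF b, of x] by (simp add: ac_simps)
      qed
      then show ?thesis
        using idB[OF b] by (simp add: cdual_def mult_scaleC_left g_scale)
    qed
    have "s \<in> B \<and> g s = F (\<lambda>x. g (x * s))"
      using s
    proof (rule span_induct)
      have "g 0 = 0"
        using g_scale[OF carrier_zero[OF ban], of 0] by simp
      then have "F (\<lambda>x. g (x * 0)) = 0"
        using F_scale[OF g_cdual[OF carrier_zero[OF ban]], of 0] by simp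
      then show "subspace {s. s \<in> B \<and> g s = F (\<lambda>x. g (x * s))}"
        unfolding subspace_def using carrier_zero[OF ban] \<open>g 0 = 0\<close>
        by (auto simp: carrier_add[OF ban] carrier_scaleC[OF ban] distrib_left mult_scaleC_right
            g_add g_scale idB g_cdual F_add F_scale)
      fix t assume "t \<in> S"
      then obtain x y where t: "t = x * y" and y: "y \<in> B" by (auto simp: S_def)
      show "t \<in> B \<and> g t = F (\<lambda>x. g (x * t))"
        \<comment> \<open>The identity for the functional z |-> g(z y) at the point
          \<open>x\<close>; by associativity it is the claim for the product x y.\<close>
        using unit[OF g_cdual[OF y], of x] idB[OF y] by (simp add: t mult.assoc)
    qed
    then have "cmod (g s) \<le> L * dual_norm B nB (\<lambda>x. g (x * s))"
      using F_le[OF g_cdual[OF sB]] by simp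
    moreover have "dual_norm B nB (\<lambda>x. g (x * s)) \<le> C * norm s"
    proof (rule dual_norm_least[OF ban])
      \<comment> \<open>Commutativity lets \<open>s\<close> act on \<open>x\<close> from the left,
        so \<open>s\<close> is measured in the ambient norm and \<open>x\<close> in
        \<open>nB\<close>.\<close>
      show "cmod (g (x * s)) \<le> C * norm s * nB x" if "x \<in> B" for x
        using g_le[OF idB[OF sB], of x] C(2)[OF that, of s] by (simp add: mult.commute[of s])
    qed (use C in simp)
    then have "L * dual_norm B nB (\<lambda>x. g (x * s)) \<le> L * (C * norm s)"
      using L by simp
    ultimately show ?thesis
      using sB gs carrier_norm_nonneg[OF ban sB] by (simp add: mult.assoc)
  qed
  define K where "K = L * C"
  have K: "K > 0" using L C by (simp add: K_def)
  have "nB b \<le> K * norm b" if b: "b \<in> B" for b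
  proof (rule field_le_epsilon)
    fix e :: real assume e: "e > 0"
    \<comment> \<open>Replacing \<open>b\<close> by \<open>s\<close> costs nB(b - s) on the left and
      K M nB(b - s) on the right, together K M + 1 times the distance.\<close>
    define d where "d = e / (K * M + 1)"
    have KM: "K * M + 1 > 0" using K M(1) by (simp add: add_pos_pos)
    have d: "d > 0" using e KM by (simp add: d_def)
    obtain s where s: "s \<in> span S" "nB (b - s) < d"
      using ess b d unfolding essential_abstract_segal_algebra_def S_def by blast
    then have sB: "s \<in> B" and s_le: "nB s \<le> K * norm s"
      using span_le by (auto simp: K_def)
    have bs: "b - s \<in> B" using carrier_diff[OF ban b sB] .
    have "nB b \<le> nB s + nB (b - s)"
      using carrier_norm_add[OF ban sB bs] by simp
    also have "\<dots> \<le> K * norm s + nB (b - s)"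
      using s_le by simp
    also have "\<dots> \<le> K * (norm b + M * nB (b - s)) + nB (b - s)"
    proof -
      have "norm s \<le> norm b + norm (b - s)"
        using norm_triangle_sub[of s b] by (simp add: norm_minus_commute)
      then show ?thesis using M(2)[OF bs] K by simp
    qed
    also have "\<dots> = K * norm b + (K * M + 1) * nB (b - s)"
      by (simp add: algebra_simps)
    also have "\<dots> \<le> K * norm b + (K * M + 1) * d"
      using s KM by (intro add_left_mono mult_left_mono) auto
    also have "\<dots> = K * norm b + e"
      using KM by (simp add: d_def)
    finally show "nB b \<le> K * norm b + e" .
  qed
  then show ?thesis using K by blast
qed

theorem theorem2p1:
  fixes B :: "'a::{complex_banach_algebra, comm_ring} set" and nB :: "'a \<Rightarrow> real"
  assumes "semisimple (UNIV :: 'a set)"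
    and "ideal_in_bidual TYPE('a)"
    and "essential_abstract_segal_algebra B nB"
  shows "BSE_algebra B nB \<longleftrightarrow> B = UNIV \<and> BSE_algebra (UNIV :: 'a set) norm"
proof -
  have seg: "abstract_segal_algebra B nB"
    using assms(3) by (simp add: essential_abstract_segal_algebra_def)
  then obtain M where ban: "banach_algebra_on B nB"
    and M: "M > 0" "\<And>b. b \<in> B \<Longrightarrow> norm b \<le> M * nB b"
    by (auto simp: abstract_segal_algebra_def)
  show ?thesis
  proof
    assume BSE: "BSE_algebra B nB"
    then obtain K where K: "K > 0" "\<And>b. b \<in> B \<Longrightarrow> nB b \<le> K * norm b"
      using essential_segal_norm_le[OF assms] by blast
    then have "B = UNIV" by (rule segal_eq_UNIV[OF seg])
    with BSE_algebra_norm_cong[of nB M K] ban M K BSE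
    show "B = UNIV \<and> BSE_algebra (UNIV :: 'a set) norm" by simp
  next
    assume A: "B = UNIV \<and> BSE_algebra (UNIV :: 'a set) norm"
    then obtain K where "K > 0" "\<And>b. nB b \<le> K * norm b"
      using complete_norm_le[of nB M] ban M by auto
    with BSE_algebra_norm_cong[of nB M K] ban M A
    show "BSE_algebra B nB" by simp
  qed
qed

end
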